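(* Let $(X,\sigma)$ be a Deaconu-Renault system and let $d_1,d_2$ be two metrics on $X$ (each inducing the topology of $X$) that are uniformly equivalent. Then $(X,\sigma,d_1)$ has the shadowing property if, and only if, $(X,\sigma,d_2)$ does; and $(X,\sigma,d_1)$ has the finite shadowing property if, and only if, $(X,\sigma,d_2)$ does.
   Context: A Deaconu-Renault system is a pair $(X,\sigma)$ consisting of a locally compact Hausdorff space $X$ and a local homeomorphism $\sigma:\mathrm{Dom}(\sigma)\to\mathrm{Im}(\sigma)$ from an open set $\mathrm{Dom}(\sigma)\subseteq X$ onto an open set $\mathrm{Im}(\sigma)\subseteq X$; inductively $\mathrm{Dom}(\sigma^n)=\sigma^{-1}(\mathrm{Dom}(\sigma^{n-1}))$, with $\sigma^0=\mathrm{id}_X$. $(X,\sigma,d)$ denotes the system with $X$ equipped with the metric $d$. Metrics $d_1,d_2$ on $X$ are uniformly equivalent if both $\mathrm{id}_X:(X,d_1)\to(X,d_2)$ and $\mathrm{id}_X:(X,d_2)\to(X,d_1)$ are uniformly continuous. A (finite) $\delta$-chain (with respect to $d$) is an infinite sequence $(x_i)_{i=1}^\infty$ (respectively a finite sequence $(x_i)_{i=1}^k$) in $X$ such that $x_i\in\mathrm{Dom}(\sigma)$ and $d(\sigma(x_i),x_{i+1})<\delta$ for all $i$ (respectively for all $1\le i<k$; the last term need not be in $\mathrm{Dom}(\sigma)$). A point $x\in X$ $\varepsilon$-shadows a finite or infinite sequence $(y_i)_{i\ge1}$ if, for all indices $i$, $x\in\mathrm{Dom}(\sigma^{i-1})$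 and $d(\sigma^{i-1}(x),y_i)<\varepsilon$. The system has the (finite) shadowing property if for every $\varepsilon>0$ there is $\delta>0$ such that every infinite (respectively every finite) $\delta$-chain is $\varepsilon$-shadowed by some $x\in X$. *)

theory Defs
  imports "HOL-Analysis.Analysis"
begin

definition local_homeomorphism_map :: "'a topology \<Rightarrow> 'b topology \<Rightarrow> ('a \<Rightarrow> 'b) \<Rightarrow> bool"
  where "local_homeomorphism_map X Y f \<longleftrightarrow>
    (\<forall>x \<in> topspace X. \<exists>U. openin X U \<and> x \<in> U \<and> openin Y (f ` U) \<and>
       homeomorphic_map (subtopology X U) (subtopology Y (f ` U)) f)"

text \<open>The partial map is a total function \<open>\<sigma>\<close> together with its domain \<open>D\<close>; the values
  of \<open>\<sigma>\<close> outside \<open>D\<close> are irrelevant. Its image is \<open>\<sigma> ` D\<close>.\<close>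

locale Deaconu_Renault_system =
  fixes X :: "'a topology" and D :: "'a set" and \<sigma> :: "'a \<Rightarrow> 'a"
  assumes locally_compact: "locally_compact_space X"
    and Hausdorff: "Hausdorff_space X"
    and open_domain: "openin X D"
    and open_image: "openin X (\<sigma> ` D)"
    and local_homeomorphism:
      "local_homeomorphism_map (subtopology X D) (subtopology X (\<sigma> ` D)) \<sigma>"

text \<open>\<open>dom_iter S D \<sigma> n\<close> is the domain of the \<open>n\<close>-th iterate of the partial map
  \<open>\<sigma>\<close> on the underlying set \<open>S\<close>; on this set the iterate is \<open>\<sigma> ^^ n\<close>.\<close>

primrec dom_iter :: "'a set \<Rightarrow> 'a set \<Rightarrow> ('a \<Rightarrow> 'a) \<Rightarrow> nat \<Rightarrow> 'a set"
  where
    "dom_iter S D \<sigma> 0 = S"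
  | "dom_iter S D \<sigma> (Suc n) = {x \<in> D. \<sigma> x \<in> dom_iter S D \<sigma> n}"

definition uniformly_equivalent :: "'a metric \<Rightarrow> 'a metric \<Rightarrow> bool"
  where "uniformly_equivalent m1 m2 \<longleftrightarrow>
    uniformly_continuous_map m1 m2 id \<and> uniformly_continuous_map m2 m1 id"

text \<open>Sequences are indexed from \<open>0\<close>. A finite sequence of length \<open>k\<close> is given by the
  values at the indices below \<open>k\<close> of a function on the naturals.\<close>

definition delta_chain :: "'a metric \<Rightarrow> 'a set \<Rightarrow> ('a \<Rightarrow> 'a) \<Rightarrow> real \<Rightarrow> (nat \<Rightarrow> 'a) \<Rightarrow> bool"
  where "delta_chain m D \<sigma> \<delta> y \<longleftrightarrow>
    (\<forall>i. y i \<in> mspace m) \<and>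
    (\<forall>i. y i \<in> D \<and> mdist m (\<sigma> (y i)) (y (Suc i)) < \<delta>)"

definition finite_delta_chain ::
    "'a metric \<Rightarrow> 'a set \<Rightarrow> ('a \<Rightarrow> 'a) \<Rightarrow> real \<Rightarrow> nat \<Rightarrow> (nat \<Rightarrow> 'a) \<Rightarrow> bool"
  where "finite_delta_chain m D \<sigma> \<delta> k y \<longleftrightarrow>
    (\<forall>i<k. y i \<in> mspace m) \<and>
    (\<forall>i. Suc i < k \<longrightarrow> y i \<in> D \<and> mdist m (\<sigma> (y i)) (y (Suc i)) < \<delta>)"

text \<open>The index set \<open>I\<close> is \<open>UNIV\<close> for infinite sequences and \<open>{..<k}\<close> for finite
  sequences of length \<open>k\<close>.\<close>

definition shadows ::
    "'a metric \<Rightarrow> 'a set \<Rightarrow> ('a \<Rightarrow> 'a) \<Rightarrow> real \<Rightarrow> nat set \<Rightarrow> 'a \<Rightarrow> (nat \<Rightarrow> 'a) \<Rightarrow> bool"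
  where "shadows m D \<sigma> \<epsilon> I x y \<longleftrightarrow>
    (\<forall>i\<in>I. x \<in> dom_iter (mspace m) D \<sigma> i \<and> mdist m ((\<sigma> ^^ i) x) (y i) < \<epsilon>)"

definition shadowing_property :: "'a metric \<Rightarrow> 'a set \<Rightarrow> ('a \<Rightarrow> 'a) \<Rightarrow> bool"
  where "shadowing_property m D \<sigma> \<longleftrightarrow>
    (\<forall>\<epsilon>>0. \<exists>\<delta>>0. \<forall>y. delta_chain m D \<sigma> \<delta> y \<longrightarrow>
       (\<exists>x\<in>mspace m. shadows m D \<sigma> \<epsilon> UNIV x y))"

text \<open>Finite chains have at least one term, so that the empty space has the property.\<close>

definition finite_shadowing_property :: "'a metric \<Rightarrow> 'a set \<Rightarrow> ('a \<Rightarrow> 'a) \<Rightarrow> bool"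
  where "finite_shadowing_property m D \<sigma> \<longleftrightarrow>
    (\<forall>\<epsilon>>0. \<exists>\<delta>>0. \<forall>k\<ge>1. \<forall>y. finite_delta_chain m D \<sigma> \<delta> k y \<longrightarrow>
       (\<exists>x\<in>mspace m. shadows m D \<sigma> \<epsilon> {..<k} x y))"

end

theory Submission
  imports Defs
begin

text \<open>Uniform equivalence allows a tolerance for one metric to be replaced by a tolerance for
  the other. Given \<open>\<epsilon>\<close> for \<open>m2\<close>, choose \<open>\<epsilon>'\<close> such that \<open>m1\<close>-distances below \<open>\<epsilon>'\<close> force
  \<open>m2\<close>-distances below \<open>\<epsilon>\<close>, take the chain tolerance \<open>\<delta>'\<close> of \<open>m1\<close> for \<open>\<epsilon>'\<close>, and choose \<open>\<delta>\<close>
  such that \<open>m2\<close>-distances below \<open>\<delta>\<close> force \<open>m1\<close>-distances below \<open>\<delta>'\<close>.\<close>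

definition dist_dominates :: "'a metric \<Rightarrow> real \<Rightarrow> 'a metric \<Rightarrow> real \<Rightarrow> bool"
  where "dist_dominates m \<delta> m' \<epsilon> \<longleftrightarrow>
    (\<forall>x\<in>mspace m. \<forall>y\<in>mspace m. mdist m x y < \<delta> \<longrightarrow> mdist m' x y < \<epsilon>)"

lemma uniformly_continuous_map_id_dist_dominates:
  assumes "uniformly_continuous_map m m' id" "\<epsilon> > 0"
  obtains \<delta> where "\<delta> > 0" "dist_dominates m \<delta> m' \<epsilon>"
proof -
  obtain \<delta> where "\<delta> > 0"
    "\<forall>x\<in>mspace m. \<forall>y\<in>mspace m. mdist m y x < \<delta> \<longrightarrow> mdist m' y x < \<epsilon>"
    using assms unfolding uniformly_continuous_map_def by (metis id_apply)
  then show thesis using that unfolding dist_dominates_def by blast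
qed

text \<open>Unfolding \<open>dom_iter\<close> n times ends in
  \<open>dom_iter S D \<sigma> 0 = S\<close>. This is needed because \<open>dist_dominates\<close>
  compares distances only between points of the space.\<close>

lemma funpow_in_space_of_dom_iter:
  assumes "\<sigma> ` D \<subseteq> S" "x \<in> dom_iter S D \<sigma> n"
  shows "(\<sigma> ^^ n) x \<in> S"
  using assms(2)
  \<comment> \<open>\<open>funpow_Suc_right\<close> applies \<sigma> first, matching the recursion
    of \<open>dom_iter\<close>, so the induction hypothesis is used at
    \<open>\<sigma> x\<close>.\<close>
  by (induction n arbitrary: x) (auto simp: funpow_Suc_right simp del: funpow.simps(2))

text \<open>Each \<open>y i\<close> lies in \<open>D\<close>, so \<open>\<sigma> (y i)\<close> lies
  in the space and domination applies to the pair \<open>\<sigma> (y i)\<close>,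
  \<open>y (Suc i)\<close>.\<close>

lemma delta_chain_dist_dominates:
  assumes "dist_dominates m \<delta> m' \<delta>'" "mspace m' = mspace m" "\<sigma> ` D \<subseteq> mspace m"
    and "delta_chain m D \<sigma> \<delta> y"
  shows "delta_chain m' D \<sigma> \<delta>' y"
  using assms unfolding delta_chain_def dist_dominates_def by (simp add: image_subset_iff)

lemma finite_delta_chain_dist_dominates:
  assumes "dist_dominates m \<delta> m' \<delta>'" "mspace m' = mspace m" "\<sigma> ` D \<subseteq> mspace m"
    and "finite_delta_chain m D \<sigma> \<delta> k y"
  shows "finite_delta_chain m' D \<sigma> \<delta>' k y"
  using assms unfolding finite_delta_chain_def dist_dominates_def by (simp add: image_subset_iff)

text \<open>The domain conditions depend on the metric only through its carrier, which is the same
  for both; domination handles the distances, since both the iterates of \<open>x\<close> and the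
  terms \<open>y i\<close> lie in the space.\<close>

lemma shadows_dist_dominates:
  assumes "dist_dominates m \<epsilon> m' \<epsilon>'" "mspace m' = mspace m" "\<sigma> ` D \<subseteq> mspace m"
    and "\<And>i. i \<in> I \<Longrightarrow> y i \<in> mspace m"
    and "shadows m D \<sigma> \<epsilon> I x y"
  shows "shadows m' D \<sigma> \<epsilon>' I x y"
  using assms funpow_in_space_of_dom_iter[OF assms(3)]
  unfolding shadows_def dist_dominates_def by simp

lemma shadowing_property_transfer:
  assumes "uniformly_equivalent m1 m2" "mspace m2 = mspace m1" "\<sigma> ` D \<subseteq> mspace m1"
    and shadowing: "shadowing_property m1 D \<sigma>"
  shows "shadowing_property m2 D \<sigma>"
  unfolding shadowing_property_def
proof (intro allI impI)
  fix \<epsilon> :: real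
  assume "\<epsilon> > 0"
  then obtain \<epsilon>' where \<epsilon>': "\<epsilon>' > 0" "dist_dominates m1 \<epsilon>' m2 \<epsilon>"
    using assms(1) uniformly_continuous_map_id_dist_dominates
    unfolding uniformly_equivalent_def by metis
  obtain \<delta>' where \<delta>': "\<delta>' > 0"
    "\<And>y. delta_chain m1 D \<sigma> \<delta>' y \<Longrightarrow> \<exists>x\<in>mspace m1. shadows m1 D \<sigma> \<epsilon>' UNIV x y"
    using shadowing \<epsilon>'(1) unfolding shadowing_property_def by metis
  obtain \<delta> where \<delta>: "\<delta> > 0" "dist_dominates m2 \<delta> m1 \<delta>'"
    using assms(1) \<delta>'(1) uniformly_continuous_map_id_dist_dominates
    unfolding uniformly_equivalent_def by metis
  have "\<exists>x\<in>mspace m2. shadows m2 D \<sigma> \<epsilon> UNIV x y" if y: "delta_chain m2 D \<sigma> \<delta> y" for y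
  proof -
    have chain: "delta_chain m1 D \<sigma> \<delta>' y"
      using delta_chain_dist_dominates[OF \<delta>(2) _ _ y] assms(2,3) by simp
    then obtain x where x: "x \<in> mspace m1" "shadows m1 D \<sigma> \<epsilon>' UNIV x y"
      using \<delta>'(2) by blast
    have "y i \<in> mspace m1" for i
      using chain unfolding delta_chain_def by blast
    then show ?thesis
      using shadows_dist_dominates[OF \<epsilon>'(2) assms(2,3) _ x(2)] x(1) assms(2) by blast
  qed
  then show "\<exists>\<delta>>0. \<forall>y. delta_chain m2 D \<sigma> \<delta> y \<longrightarrow>
      (\<exists>x\<in>mspace m2. shadows m2 D \<sigma> \<epsilon> UNIV x y)"
    using \<delta>(1) by blast
qed

lemma finite_shadowing_property_transfer:
  assumes "uniformly_equivalent m1 m2" "mspace m2 = mspace m1" "\<sigma> ` D \<subseteq> mspace m1"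
    and shadowing: "finite_shadowing_property m1 D \<sigma>"
  shows "finite_shadowing_property m2 D \<sigma>"
  unfolding finite_shadowing_property_def
proof (intro allI impI)
  fix \<epsilon> :: real
  assume "\<epsilon> > 0"
  then obtain \<epsilon>' where \<epsilon>': "\<epsilon>' > 0" "dist_dominates m1 \<epsilon>' m2 \<epsilon>"
    using assms(1) uniformly_continuous_map_id_dist_dominates
    unfolding uniformly_equivalent_def by metis
  obtain \<delta>' where \<delta>': "\<delta>' > 0"
    \<comment> \<open>One tolerance serves all lengths \<open>k\<close>, so the \<delta> derived
      from it below is also independent of \<open>k\<close>.\<close>
    "\<And>k y. k \<ge> 1 \<Longrightarrow> finite_delta_chain m1 D \<sigma> \<delta>' k y \<Longrightarrow>
      \<exists>x\<in>mspace m1. shadows m1 D \<sigma> \<epsilon>' {..<k} x y"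
    using shadowing \<epsilon>'(1) unfolding finite_shadowing_property_def by metis
  obtain \<delta> where \<delta>: "\<delta> > 0" "dist_dominates m2 \<delta> m1 \<delta>'"
    using assms(1) \<delta>'(1) uniformly_continuous_map_id_dist_dominates
    unfolding uniformly_equivalent_def by metis
  have "\<exists>x\<in>mspace m2. shadows m2 D \<sigma> \<epsilon> {..<k} x y"
    if k: "k \<ge> 1" and y: "finite_delta_chain m2 D \<sigma> \<delta> k y" for k y
  proof -
    have chain: "finite_delta_chain m1 D \<sigma> \<delta>' k y"
      using finite_delta_chain_dist_dominates[OF \<delta>(2) _ _ y] assms(2,3) by simp
    then obtain x where x: "x \<in> mspace m1" "shadows m1 D \<sigma> \<epsilon>' {..<k} x y"
      using \<delta>'(2) k by blast
    \<comment> \<open>A finite chain is constrained only below \<open>k\<close>, which is exactly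
      the index set on which shadowing is required.\<close>
    have "y i \<in> mspace m1" if "i \<in> {..<k}" for i
      using chain that unfolding finite_delta_chain_def by blast
    then show ?thesis
      using shadows_dist_dominates[OF \<epsilon>'(2) assms(2,3) _ x(2)] x(1) assms(2) by blast
  qed
  then show "\<exists>\<delta>>0. \<forall>k\<ge>1. \<forall>y. finite_delta_chain m2 D \<sigma> \<delta> k y \<longrightarrow>
      (\<exists>x\<in>mspace m2. shadows m2 D \<sigma> \<epsilon> {..<k} x y)"
    using \<delta>(1) by blast
qed

theorem proposition2p12:
  fixes X :: "'a topology" and D :: "'a set" and \<sigma> :: "'a \<Rightarrow> 'a"
    and m1 m2 :: "'a metric"
  assumes "Deaconu_Renault_system X D \<sigma>"
    and "mtopology_of m1 = X"
    and "mtopology_of m2 = X"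
    and "uniformly_equivalent m1 m2"
  shows "(shadowing_property m1 D \<sigma> \<longleftrightarrow> shadowing_property m2 D \<sigma>) \<and>
    (finite_shadowing_property m1 D \<sigma> \<longleftrightarrow> finite_shadowing_property m2 D \<sigma>)"
proof -
  \<comment> \<open>A metric's carrier is the underlying set of its topology, so the two carriers
    agree.\<close>
  have space: "mspace m1 = topspace X" "mspace m2 = topspace X"
    using assms(2,3) topspace_mtopology_of by metis+
  have image: "\<sigma> ` D \<subseteq> topspace X"
    using Deaconu_Renault_system.open_image[OF assms(1)] by (rule openin_subset)
  \<comment> \<open>With symmetry, the one-way transfer lemmas yield both directions of each
    equivalence.\<close>
  have sym: "uniformly_equivalent m2 m1"
    using assms(4) unfolding uniformly_equivalent_def by blast
  show ?thesis
    using shadowing_property_transfer[OF assms(4)] shadowing_property_transfer[OF sym]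
      finite_shadowing_property_transfer[OF assms(4)] finite_shadowing_property_transfer[OF sym]
      space image
    by metis
qed

end
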